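(* Let $q\in\mathbb Q_{>0}$ and $c,d\in\mathbb Z\setminus\{0\}$. Then the pattern $$x,\quad y,\quad cx+dy,\quad q\cdot\frac yx$$ is partition regular if and only if $c=d=1$.
   Context: $\mathbb N$ denotes the set of positive integers ($0\notin\mathbb N$). A pattern $f_1(x,y),\dots,f_k(x,y)$ (with the $f_i$ rational-valued functions) is called partition regular if, for every finite colouring (partition into finitely many pieces) of $\mathbb N$, the set of monochromatic $k$-tuples $(f_1(u,v),\dots,f_k(u,v))$ with $u,v\in\mathbb N$ is infinite; here a tuple is monochromatic if all its entries belong to $\mathbb N$ and lie in the same colour. *)

theory Defs
  imports Complex_Main "HOL-Library.Disjoint_Sets"
begin

text \<open>
  The positive integers are the set \<open>{0<..}\<close> of natural numbers. A pattern is the list of its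
  component functions; these may take arbitrary rational values, so a tuple of values is a
  list of rationals. A finite colouring is a finite partition \<open>P\<close> of the positive integers,
  whose members are the colour classes.
\<close>

definition monochromatic :: "nat set set \<Rightarrow> rat list \<Rightarrow> bool" where
  "monochromatic P t \<longleftrightarrow> (\<exists>C\<in>P. \<forall>z\<in>set t. \<exists>n\<in>C. z = of_nat n)"

definition partition_regular :: "(nat \<Rightarrow> nat \<Rightarrow> rat) list \<Rightarrow> bool" where
  "partition_regular fs \<longleftrightarrow>
     (\<forall>P. partition_on {0<..} P \<and> finite P \<longrightarrow>
        infinite {t. monochromatic P t \<and> (\<exists>u>0. \<exists>v>0. t = map (\<lambda>f. f u v) fs)})"

end

theory Submission
  imports Defs "HOL-Library.Infinite_Set" "HOL-Computational_Algebra.Primes"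
begin

text \<open>
  Sufficiency: let \<open>U\<close> be an additively idempotent ultrafilter containing all sets of multiples.
  For a finite colouring, let \<open>t x\<close> be the colour of \<open>q y / x\<close> for \<open>U\<close>-most \<open>y\<close>. On a set of \<open>U\<close>
  the value of \<open>t\<close> is constant, and idempotence yields \<open>x\<^sub>1, x\<^sub>2, x\<^sub>3\<close> such that
  \<open>q x\<^sub>2 / x\<^sub>1\<close>, \<open>q x\<^sub>3 / x\<^sub>1\<close>, \<open>q (x\<^sub>2 + x\<^sub>3) / x\<^sub>1\<close> and \<open>q x\<^sub>3 / x\<^sub>2\<close> all have this colour.
  With \<open>x\<close> and \<open>y\<close> the first two, these are \<open>x\<close>, \<open>y\<close>, \<open>x + y\<close> and \<open>q y / x\<close>.

  Necessity: if all entries are large, the last one forces \<open>y\<close> to be much larger than \<open>x\<close>, so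
  that \<open>c x + d y\<close> is about \<open>d y\<close>; colouring by the position on a logarithmic scale to base \<open>d\<close>
  excludes this unless \<open>d = 1\<close>. Likewise, for a large prime \<open>p\<close>, if \<open>p\<close> divides all entries then \<open>y\<close>
  has larger \<open>p\<close>-adic valuation than \<open>x\<close>, so that the last nonzero base-\<open>p\<close> digits of \<open>x\<close> and
  \<open>c x + y\<close> differ by the factor \<open>c\<close>; if \<open>p\<close> divides no entry, residues modulo \<open>p\<close> suffice.
\<close>

section \<open>Minimal proper filters and ultrafilters\<close>

text \<open>Zorn's lemma for the reversed order: a set in the infimum of a nonempty chain already
  lies in one member, so the infimum stays proper. Trivial \<open>Q\<close> gives ultrafilters;
  idempotence gives the minimal objects for Ellis--Numakura.\<close>

lemma minimal_proper_filter:
  fixes F0 :: "'a filter"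
  assumes "Q F0" "F0 \<noteq> bot"
    and Inf: "\<And>C. C \<noteq> {} \<Longrightarrow> (\<And>F G. F \<in> C \<Longrightarrow> G \<in> C \<Longrightarrow> F \<le> G \<or> G \<le> F) \<Longrightarrow>
      (\<And>F. F \<in> C \<Longrightarrow> Q F) \<Longrightarrow> Q (Inf C)"
  obtains F where "F \<le> F0" "F \<noteq> bot" "Q F"
    "\<And>G. G \<le> F \<Longrightarrow> G \<noteq> bot \<Longrightarrow> Q G \<Longrightarrow> G = F"
proof -
  define A where "A = {F. F \<le> F0 \<and> F \<noteq> bot \<and> Q F}"
  have "partial_order_on A (relation_of (\<ge>) A)"
    by (rule partial_order_on_relation_ofI) auto
  moreover have "\<exists>U\<in>A. \<forall>F\<in>C. F \<ge> U" if C: "C \<in> Chains (relation_of (\<ge>) A)" for C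
  proof (cases "C = {}")
    case True
    then show ?thesis using assms by (auto simp: A_def)
  next
    case False
    have CA: "C \<subseteq> A" and ch: "\<And>F G. F \<in> C \<Longrightarrow> G \<in> C \<Longrightarrow> F \<le> G \<or> G \<le> F"
      using C by (auto simp: Chains_def relation_of_def)
    have "Q (Inf C)"
      using False CA ch by (intro Inf) (auto simp: A_def)
    moreover have "Inf C \<le> F0"
      using False CA by (auto simp: A_def intro: Inf_lower2)
    moreover have "Inf C \<noteq> bot"
    proof
      assume "Inf C = bot"
      then have "eventually (\<lambda>_. False) (Inf C)" by simp
      then obtain F where "F \<in> C" "eventually (\<lambda>_. False) F"
        using False ch by (subst (asm) eventually_Inf_base) (metis inf.absorb1 inf.absorb2 order_refl)+
      then show False using CA by (auto simp: A_def trivial_limit_def)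
    qed
    ultimately show ?thesis
      by (auto simp: A_def intro!: bexI[of _ "Inf C"] Inf_lower)
  qed
  ultimately obtain F where "F \<in> A" "\<forall>G\<in>A. F \<ge> G \<longrightarrow> G = F"
    using predicate_Zorn[of A "(\<ge>)"] by blast
  then show thesis
    by (intro that[of F]) (auto simp: A_def)
qed

definition ultrafilter :: "'a filter \<Rightarrow> bool" where
  "ultrafilter F \<longleftrightarrow> F \<noteq> bot \<and> (\<forall>P. eventually P F \<or> eventually (\<lambda>x. \<not> P x) F)"

lemma ultrafilter_not_eventually:
  assumes "ultrafilter F"
  shows "\<not> eventually P F \<longleftrightarrow> eventually (\<lambda>x. \<not> P x) F"
proof
  assume *: "eventually (\<lambda>x. \<not> P x) F"
  show "\<not> eventually P F"
  proof
    assume "eventually P F"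
    with * have "eventually (\<lambda>_. False) F" by eventually_elim simp
    with assms show False by (simp add: ultrafilter_def)
  qed
next
  assume "\<not> eventually P F"
  with assms show "eventually (\<lambda>x. \<not> P x) F" unfolding ultrafilter_def by blast
qed

text \<open>A minimal proper filter decides every set: if the complement is not in it, adjoining the
  set keeps it proper and hence unchanged.\<close>

lemma ultrafilter_exists:
  fixes F0 :: "'a filter"
  assumes "F0 \<noteq> bot"
  obtains F where "F \<le> F0" "ultrafilter F"
proof -
  obtain F where F: "F \<le> F0" "F \<noteq> bot" and min: "\<And>G. G \<le> F \<Longrightarrow> G \<noteq> bot \<Longrightarrow> G = F"
    using minimal_proper_filter[of "\<lambda>_. True" F0] assms by metis
  have "eventually P F \<or> eventually (\<lambda>x. \<not> P x) F" for P
  proof (rule disjCI)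
    assume *: "\<not> eventually (\<lambda>x. \<not> P x) F"
    then have "inf F (principal {x. P x}) \<noteq> bot"
      by (simp add: trivial_limit_def eventually_inf_principal)
    then have "inf F (principal {x. P x}) = F"
      by (intro min) auto
    moreover have "eventually P (inf F (principal {x. P x}))"
      by (simp add: eventually_inf_principal)
    ultimately show "eventually P F" by simp
  qed
  then show thesis using that F unfolding ultrafilter_def by blast
qed

lemma ultrafilter_eventually_bex:
  assumes "ultrafilter F" "finite I" "eventually (\<lambda>x. \<exists>i\<in>I. R i x) F"
  obtains i where "i \<in> I" "eventually (R i) F"
proof (rule ccontr)
  assume "\<not> thesis"
  then have "\<forall>i\<in>I. eventually (\<lambda>x. \<not> R i x) F"
    using that assms(1) by (auto simp: ultrafilter_def)
  then have "eventually (\<lambda>x. \<forall>i\<in>I. \<not> R i x) F"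
    using assms(2) by (simp add: eventually_ball_finite)
  with assms(3) have "eventually (\<lambda>_. False) F" by eventually_elim blast
  then show False using assms(1) by (simp add: ultrafilter_def)
qed

section \<open>Sums of filters and idempotent ultrafilters\<close>

text \<open>For an ultrafilter this is \<open>U + U = U\<close> in the Stone-Cech compactification.
  For a filter it makes the closed set of ultrafilters below it a subsemigroup.\<close>

definition idempotent_filter :: "'a::plus filter \<Rightarrow> bool" where
  "idempotent_filter F \<longleftrightarrow>
     (\<forall>P. eventually P F \<longrightarrow> eventually (\<lambda>k. eventually (\<lambda>m. P (k + m)) F) F)"

definition filter_sum :: "'a::plus filter \<Rightarrow> 'a filter \<Rightarrow> 'a filter" where
  "filter_sum F G = Abs_filter (\<lambda>P. eventually (\<lambda>k. eventually (\<lambda>m. P (k + m)) G) F)"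

lemma eventually_filter_sum:
  "eventually P (filter_sum F G) \<longleftrightarrow> eventually (\<lambda>k. eventually (\<lambda>m. P (k + m)) G) F"
  unfolding filter_sum_def
proof (rule eventually_Abs_filter, unfold_locales, goal_cases)
  case 1 then show ?case by simp
next
  case (2 P Q)
  then show ?case by eventually_elim (rule eventually_conj)
next
  case (3 P Q)
  show ?case by (rule eventually_mono[OF 3(2)]) (auto elim!: eventually_mono simp: 3(1))
qed

lemma idempotent_filter_iff: "idempotent_filter F \<longleftrightarrow> filter_sum F F \<le> F"
  by (simp add: idempotent_filter_def le_filter_def eventually_filter_sum)

lemma filter_sum_mono: "F \<le> F' \<Longrightarrow> G \<le> G' \<Longrightarrow> filter_sum F G \<le> filter_sum F' G'"
  unfolding le_filter_def[of "filter_sum F G"] eventually_filter_sum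
  by (blast intro: filter_leD eventually_mono)

text \<open>The Ellis--Numakura lemma, with filters playing the role of closed subsets of the
  Stone--Cech compactification.\<close>

lemma idempotent_ultrafilter_exists:
  fixes F0 :: "'a::semigroup_add filter"
  assumes "idempotent_filter F0" "F0 \<noteq> bot"
  obtains U where "U \<le> F0" "ultrafilter U" "idempotent_filter U"
proof -
  have Inf: "idempotent_filter (Inf C)"
    if "C \<noteq> {}" "\<And>F G. F \<in> C \<Longrightarrow> G \<in> C \<Longrightarrow> F \<le> G \<or> G \<le> F"
      "\<And>F. F \<in> C \<Longrightarrow> idempotent_filter F" for C :: "'a filter set"
    unfolding idempotent_filter_iff
  proof (rule Inf_greatest)
    fix F assume F: "F \<in> C"
    have "filter_sum (Inf C) (Inf C) \<le> filter_sum F F"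
      using F by (intro filter_sum_mono Inf_lower)
    also have "\<dots> \<le> F" using that(3)[OF F] by (simp add: idempotent_filter_iff)
    finally show "filter_sum (Inf C) (Inf C) \<le> F" .
  qed
  obtain F where F: "F \<le> F0" "F \<noteq> bot" "idempotent_filter F"
    and min: "\<And>G. G \<le> F \<Longrightarrow> G \<noteq> bot \<Longrightarrow> idempotent_filter G \<Longrightarrow> G = F"
    by (rule minimal_proper_filter[of idempotent_filter, OF assms]) (use Inf in \<open>blast+\<close>)
  obtain U where U: "U \<le> F" "ultrafilter U"
    using ultrafilter_exists[OF F(2)] by metis
  \<comment> \<open>Corresponds to \<open>K + u = K\<close> for a minimal closed subsemigroup
    \<open>K\<close> and \<open>u\<close> in \<open>K\<close>.\<close>
  have FU: "filter_sum F U = F"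
  proof (rule min)
    show le: "filter_sum F U \<le> F"
      using F(3) U(1) filter_sum_mono[of F F U F] by (simp add: idempotent_filter_iff)
    show "filter_sum F U \<noteq> bot"
      using F(2) U(2) by (simp add: trivial_limit_def eventually_filter_sum ultrafilter_def)
    show "idempotent_filter (filter_sum F U)"
      unfolding idempotent_filter_def
    proof (intro allI impI)
      fix P assume "eventually P (filter_sum F U)"
      then have "eventually (\<lambda>k. eventually (\<lambda>m. P (k + m)) U) F"
        by (simp add: eventually_filter_sum)
      then have "eventually (\<lambda>n. eventually (\<lambda>k. eventually (\<lambda>m. P (n + k + m)) U) F) F"
        using F(3) unfolding idempotent_filter_def by blast
      then have "eventually (\<lambda>n. eventually (\<lambda>m. P (n + m)) (filter_sum F U)) F"
        by (simp add: eventually_filter_sum add.assoc)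
      then show "eventually (\<lambda>n. eventually (\<lambda>m. P (n + m)) (filter_sum F U)) (filter_sum F U)"
        by (rule filter_leD[OF le])
    qed
  qed
  \<comment> \<open>The filter of the closed semigroup of all \<open>V\<close> with \<open>V + U = U\<close>.\<close>
  define S where
    "S = Abs_filter (\<lambda>P. \<exists>Q. eventually Q U \<and> (\<forall>k. eventually (\<lambda>m. Q (k + m)) U \<longrightarrow> P k))"
  have S: "eventually P S \<longleftrightarrow> (\<exists>Q. eventually Q U \<and> (\<forall>k. eventually (\<lambda>m. Q (k + m)) U \<longrightarrow> P k))" for P
    unfolding S_def
  proof (rule eventually_Abs_filter, unfold_locales, goal_cases)
    case 1 then show ?case by (auto intro: exI[of _ "\<lambda>_. True"])
  next
    case (2 P P')
    then obtain Q Q' where Q: "eventually Q U" "\<forall>k. eventually (\<lambda>m. Q (k + m)) U \<longrightarrow> P k"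
      and Q': "eventually Q' U" "\<forall>k. eventually (\<lambda>m. Q' (k + m)) U \<longrightarrow> P' k" by blast
    show ?case
      by (rule exI[of _ "\<lambda>x. Q x \<and> Q' x"]) (use Q Q' in \<open>auto simp: eventually_conj_iff\<close>)
  next
    case 3 then show ?case by blast
  qed
  have "inf F S = F"
  proof (rule min)
    \<comment> \<open>Properness rests on \<open>FU\<close>: otherwise the complement of some
      \<open>Q\<close> in \<open>U\<close> would lie in \<open>filter_sum F U = F\<close>, hence in
      \<open>U\<close>.\<close>
    show "inf F S \<noteq> bot"
    proof
      assume "inf F S = bot"
      then have "eventually (\<lambda>_. False) (inf F S)" by simp
      then obtain Y Q where Y: "eventually Y F" and Q: "eventually Q U"
        and YQ: "\<And>k. Y k \<Longrightarrow> \<not> eventually (\<lambda>m. Q (k + m)) U"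
        unfolding eventually_inf S by blast
      from Y have "eventually (\<lambda>k. eventually (\<lambda>m. \<not> Q (k + m)) U) F"
        by eventually_elim (use YQ in \<open>simp add: ultrafilter_not_eventually[OF U(2), symmetric]\<close>)
      then have "eventually (\<lambda>m. \<not> Q m) F"
        by (subst FU[symmetric]) (simp add: eventually_filter_sum)
      then have "eventually (\<lambda>m. \<not> Q m) U" by (rule filter_leD[OF U(1)])
      with Q show False by (simp add: ultrafilter_not_eventually[OF U(2), symmetric])
    qed
    show "idempotent_filter (inf F S)"
      unfolding idempotent_filter_def
    proof (intro allI impI)
      fix X assume "eventually X (inf F S)"
      then obtain Y Q where Y: "eventually Y F" and Q: "eventually Q U"
        and YQ: "\<And>k. Y k \<Longrightarrow> eventually (\<lambda>m. Q (k + m)) U \<Longrightarrow> X k"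
        unfolding eventually_inf S by blast
      have "eventually (\<lambda>n. eventually (\<lambda>k. Y (n + k)) F) F"
        using F(3) Y unfolding idempotent_filter_def by blast
      moreover have "eventually (\<lambda>n. eventually (\<lambda>m. Q (n + m)) U) S"
        unfolding S using Q by blast
      ultimately show "eventually (\<lambda>n. eventually (\<lambda>k. X (n + k)) (inf F S)) (inf F S)"
      proof (rule eventually_inf[THEN iffD2, OF exI, OF exI, OF conjI, OF _ conjI], intro allI impI)
        fix n assume n: "eventually (\<lambda>k. Y (n + k)) F \<and> eventually (\<lambda>m. Q (n + m)) U"
        \<comment> \<open>The shifted set of all \<open>m\<close> with \<open>Q (n + m)\<close> is
          again in \<open>U\<close>, so it serves as the witness in \<open>S\<close>.\<close>
        then have "eventually (\<lambda>k. eventually (\<lambda>m. Q (n + (k + m))) U) S"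
          unfolding S by blast
        with n show "eventually (\<lambda>k. X (n + k)) (inf F S)"
          unfolding eventually_inf
          by (intro exI[of _ "\<lambda>k. Y (n + k)"]
              exI[of _ "\<lambda>k. eventually (\<lambda>m. Q (n + (k + m))) U"] conjI)
            (use YQ in \<open>simp_all add: add.assoc\<close>)
      qed
    qed
  qed simp
  \<comment> \<open>Hence \<open>U \<le> F \<le> S\<close>, so \<open>U\<close> itself solves
    \<open>V + U = U\<close>.\<close>
  then have FS: "F \<le> S" by (metis inf.cobounded2)
  have "idempotent_filter U"
    unfolding idempotent_filter_def
  proof (intro allI impI)
    fix Q assume "eventually Q U"
    then have "eventually (\<lambda>k. eventually (\<lambda>m. Q (k + m)) U) S" unfolding S by blast
    then show "eventually (\<lambda>k. eventually (\<lambda>m. Q (k + m)) U) U"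
      by (intro filter_leD[OF U(1)] filter_leD[OF FS])
  qed
  then show thesis using that U F(1) by (meson order_trans)
qed

text \<open>The multiples of \<open>n\<close> are closed under addition, so the filter they generate
  is idempotent. Positivity excludes the principal ultrafilter at 0.\<close>

lemma idempotent_ultrafilter_dvd_exists:
  obtains U :: "nat filter" where "ultrafilter U" "idempotent_filter U"
    "\<And>n. n > 0 \<Longrightarrow> eventually (\<lambda>m. m > 0 \<and> n dvd m) U"
proof -
  define F where "F = Abs_filter (\<lambda>P. \<exists>n>0. \<forall>m>0. n dvd m \<longrightarrow> P (m::nat))"
  have F: "eventually P F \<longleftrightarrow> (\<exists>n>0. \<forall>m>0. n dvd m \<longrightarrow> P m)" for P
    unfolding F_def
  proof (rule eventually_Abs_filter, unfold_locales, goal_cases)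
    case (2 P Q)
    then obtain n k where "n > 0" "\<forall>m>0. n dvd m \<longrightarrow> P m" "k > 0" "\<forall>m>0. k dvd m \<longrightarrow> Q m" by blast
    then show ?case by (intro exI[of _ "n * k"]) (auto dest: dvd_mult_left dvd_mult_right)
  qed auto
  have "F \<noteq> bot" by (auto simp: trivial_limit_def F)
  moreover have "idempotent_filter F"
    unfolding idempotent_filter_def F
  proof (intro allI impI)
    fix P assume "\<exists>n>0. \<forall>m>0. n dvd m \<longrightarrow> P (m::nat)"
    then obtain n where "n > 0" "\<forall>m>0. n dvd m \<longrightarrow> P m" by blast
    then show "\<exists>n>0. \<forall>m>0. n dvd m \<longrightarrow> (\<exists>n>0. \<forall>k>0. n dvd k \<longrightarrow> P (m + k))"
      by (intro exI[of _ n]) auto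
  qed
  ultimately obtain U where U: "U \<le> F" "ultrafilter U" "idempotent_filter U"
    using idempotent_ultrafilter_exists by metis
  moreover have "eventually (\<lambda>m. m > 0 \<and> n dvd m) U" if "n > 0" for n
    by (rule filter_leD[OF U(1)]) (use that in \<open>auto simp: F\<close>)
  ultimately show thesis using that by blast
qed

section \<open>Sufficiency: monochromatic solutions from the ultrafilter\<close>

lemma monochromatic_sum_quotient:
  fixes q :: rat and P :: "nat set set"
  assumes "q > 0" and P: "partition_on {0<..} P" "finite P"
  obtains x y z w C where "x > N" "y > 0" "C \<in> P" "{x, y, z, w} \<subseteq> C" "z = x + y"
    "of_nat w = q * (of_nat y / of_nat x)"
proof -
  obtain U where U: "ultrafilter U" "idempotent_filter U"
    and dvd: "\<And>n. n > 0 \<Longrightarrow> eventually (\<lambda>m::nat. m > 0 \<and> n dvd m) U"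
    using idempotent_ultrafilter_dvd_exists by metis
  have "U \<noteq> bot" using U(1) by (simp add: ultrafilter_def)
  \<comment> \<open>The bound \<open>k > N\<close> is built in because the final \<open>x\<close>
    will be such a \<open>k\<close>.\<close>
  define R where "R C x y \<longleftrightarrow> (\<exists>k>N. k \<in> C \<and> of_nat k = q * (of_nat y / of_nat x))"
    for C and x y :: nat
  obtain a b where ab: "q = of_int a / of_int b" "b > 0"
    by (metis surj_pair quotient_of_div quotient_of_denom_pos)
  then have "a > 0" using \<open>q > 0\<close> by (simp add: zero_less_divide_iff)
  then obtain a' b' where ab': "a' > 0" "b' > 0" "q = of_nat a' / of_nat b'"
    using ab by (metis of_int_of_nat_eq pos_int_cases)
  have ex: "\<exists>C\<in>P. eventually (R C x) U" if "x > 0" for x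
  proof -
    \<comment> \<open>For multiples \<open>y\<close> of this number the quotient is an integer,
      thanks to \<open>b' * x\<close>, and exceeds \<open>N\<close>, thanks to
      \<open>Suc N\<close>.\<close>
    have "b' * x * Suc N > 0" using ab' \<open>x > 0\<close> by simp
    from dvd[OF this] have "eventually (\<lambda>y. \<exists>C\<in>P. R C x y) U"
    proof eventually_elim
      case (elim y)
      then obtain s where s: "y = b' * x * Suc N * s" "s > 0" by fastforce
      define t where "t = Suc N * s"
      have t: "y = b' * x * t" by (simp only: s(1) t_def mult.assoc)
      define k where "k = a' * t"
      have "t > N" unfolding t_def using s(2) by (cases s) auto
      moreover have "t \<le> k" unfolding k_def using ab'(1) by simp
      ultimately have "k > N" by simp
      moreover from this have "k \<in> \<Union>P" using partition_onD1[OF P(1)] by auto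
      then obtain C where "C \<in> P" "k \<in> C" by blast
      moreover have "of_nat k = q * (of_nat y / of_nat x)"
        unfolding ab'(3) t k_def using ab' \<open>x > 0\<close> by simp
      ultimately show ?case unfolding R_def by blast
    qed
    then show ?thesis using ultrafilter_eventually_bex[OF U(1) P(2)] by metis
  qed
  \<comment> \<open>A second pigeonhole, now over \<open>x\<close>, makes the colour the same for
    \<open>U\<close>-most \<open>x\<close>.\<close>
  have "eventually (\<lambda>x. \<exists>C\<in>P. x > 0 \<and> eventually (R C x) U) U"
    using dvd[OF zero_less_one] by eventually_elim (use ex in auto)
  then obtain C where C: "C \<in> P" "eventually (\<lambda>x. x > 0 \<and> eventually (R C x) U) U"
    by (rule ultrafilter_eventually_bex[OF U(1) P(2)])
  obtain x\<^sub>1 where x1: "x\<^sub>1 > 0" "eventually (R C x\<^sub>1) U"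
    using eventually_happens'[OF \<open>U \<noteq> bot\<close> C(2)] by blast
  \<comment> \<open>Idempotence supplies the colour of the sum \<open>x\<^sub>2 + x\<^sub>3\<close>
    over \<open>x\<^sub>1\<close>.\<close>
  have "eventually (\<lambda>k. eventually (\<lambda>m. R C x\<^sub>1 (k + m)) U) U"
    using U(2) x1(2) unfolding idempotent_filter_def by blast
  with C(2) x1(2) have *: "eventually (\<lambda>k. R C x\<^sub>1 k \<and> k > 0 \<and> eventually (R C k) U
      \<and> eventually (\<lambda>m. R C x\<^sub>1 (k + m)) U) U"
    by eventually_elim auto
  then obtain x\<^sub>2 where x2: "R C x\<^sub>1 x\<^sub>2" "x\<^sub>2 > 0" "eventually (R C x\<^sub>2) U"
    "eventually (\<lambda>m. R C x\<^sub>1 (x\<^sub>2 + m)) U"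
    using eventually_happens'[OF \<open>U \<noteq> bot\<close> *] by blast
  from x1(2) x2(3,4) have *: "eventually (\<lambda>m. R C x\<^sub>1 m \<and> R C x\<^sub>2 m \<and> R C x\<^sub>1 (x\<^sub>2 + m)) U"
    by eventually_elim auto
  then obtain x\<^sub>3 where x3: "R C x\<^sub>1 x\<^sub>3" "R C x\<^sub>2 x\<^sub>3" "R C x\<^sub>1 (x\<^sub>2 + x\<^sub>3)"
    using eventually_happens'[OF \<open>U \<noteq> bot\<close> *] by blast
  obtain x where x: "x > N" "x \<in> C" "of_nat x = q * (of_nat x\<^sub>2 / of_nat x\<^sub>1)"
    using x2(1) by (auto simp: R_def)
  obtain y where y: "y > N" "y \<in> C" "of_nat y = q * (of_nat x\<^sub>3 / of_nat x\<^sub>1)"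
    using x3(1) by (auto simp: R_def)
  obtain z where z: "z \<in> C" "of_nat z = q * (of_nat (x\<^sub>2 + x\<^sub>3) / of_nat x\<^sub>1)"
    using x3(3) by (auto simp: R_def)
  obtain w where w: "w \<in> C" "of_nat w = q * (of_nat x\<^sub>3 / of_nat x\<^sub>2)"
    using x3(2) by (auto simp: R_def)
  have "(of_nat z :: rat) = of_nat (x + y)"
    using x y z by (simp add: add_divide_distrib distrib_left)
  then have "z = x + y" by (simp only: of_nat_eq_iff)
  \<comment> \<open>In \<open>y / x\<close> both \<open>q\<close> and \<open>x\<^sub>1\<close>
    cancel, leaving \<open>x\<^sub>3 / x\<^sub>2\<close>.\<close>
  moreover have "of_nat w = q * (of_nat y / of_nat x)"
    unfolding w(2) x(3) y(3) using x1(1) x2(2) \<open>q > 0\<close> by simp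
  ultimately show thesis using that[of x y C z w] C(1) x y z w by simp
qed

abbreviation sum_quotient_pattern :: "rat \<Rightarrow> int \<Rightarrow> int \<Rightarrow> (nat \<Rightarrow> nat \<Rightarrow> rat) list" where
  "sum_quotient_pattern q c d \<equiv>
    [\<lambda>x y. of_nat x,
     \<lambda>x y. of_nat y,
     \<lambda>x y. of_int c * of_nat x + of_int d * of_nat y,
     \<lambda>x y. q * (of_nat y / of_nat x)]"

lemma partition_regular_sum_quotient:
  assumes "q > 0"
  shows "partition_regular (sum_quotient_pattern q 1 1)"
  unfolding partition_regular_def
proof (intro allI impI, elim conjE)
  fix P :: "nat set set" assume P: "partition_on {0<..} P" "finite P"
  let ?fs = "sum_quotient_pattern q 1 1"
  let ?S = "{t. monochromatic P t \<and> (\<exists>u>0. \<exists>v>0. t = map (\<lambda>f. f u v) ?fs)}"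
  \<comment> \<open>Infinitely many tuples follow from unbounded first entries.\<close>
  have "\<exists>x>N. x \<in> {x. of_nat x \<in> hd ` ?S}" for N
  proof -
    obtain x y z w C where *: "x > N" "y > 0" "C \<in> P" "{x, y, z, w} \<subseteq> C" "z = x + y"
      "of_nat w = q * (of_nat y / of_nat x)"
      using monochromatic_sum_quotient[OF assms P] by metis
    let ?t = "map (\<lambda>f. f x y) ?fs"
    have t: "?t = map of_nat [x, y, z, w]" using * by simp
    have "monochromatic P ?t"
      unfolding t monochromatic_def using *(3,4) by (intro bexI[of _ C]) auto
    then have "?t \<in> ?S" using * by auto
    then have "of_nat x \<in> hd ` ?S" by (rule image_eqI[rotated]) simp
    then show ?thesis using * by auto
  qed
  then have "infinite {x. of_nat x \<in> hd ` ?S}"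
    unfolding infinite_nat_iff_unbounded by blast
  then show "infinite ?S"
    using finite_vimageI[of "hd ` ?S" "of_nat :: nat \<Rightarrow> rat"]
    by (auto simp: vimage_def inj_on_def)
qed

section \<open>Necessity: colourings that exclude the other coefficients\<close>

text \<open>Lets colourings be given as functions of finite range; the nonempty fibres over the
  positive integers form the partition.\<close>

lemma partition_regular_colouring:
  fixes g :: "nat \<Rightarrow> 'a"
  assumes reg: "partition_regular fs" and g: "finite (range g)"
  shows "infinite {t. (\<exists>k. \<forall>z\<in>set t. \<exists>n>0. z = of_nat n \<and> g n = k) \<and>
    (\<exists>u>0. \<exists>v>0. t = map (\<lambda>f. f u v) fs)}" (is "infinite ?T")
proof -
  define P where "P = (\<lambda>k. {n. n > 0 \<and> g n = k}) ` g ` {0<..}"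
  have "partition_on {0<..} P"
    unfolding partition_on_def disjoint_def P_def by auto
  moreover have "finite P"
    unfolding P_def by (intro finite_imageI finite_subset[OF _ g]) auto
  ultimately have "infinite {t. monochromatic P t \<and> (\<exists>u>0. \<exists>v>0. t = map (\<lambda>f. f u v) fs)}"
    using reg by (auto simp: partition_regular_def)
  moreover have "\<exists>k. \<forall>z\<in>set t. \<exists>n>0. z = of_nat n \<and> g n = k" if mono: "monochromatic P t" for t
  proof -
    obtain C where "C \<in> P" "\<forall>z\<in>set t. \<exists>n\<in>C. z = of_nat n"
      using mono by (auto simp: monochromatic_def)
    then show ?thesis unfolding P_def by fastforce
  qed
  ultimately show ?thesis
    by (elim contrapos_nn finite_subset[rotated]) auto
qed

text \<open>Refining the colour by \<open>min n N\<close> gives each number below \<open>N\<close> a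
  class of its own. Monochromatic tuples in these classes are constant, hence finitely many, so some
  tuple has all entries at least \<open>N\<close>.\<close>

lemma sum_quotient_solution:
  fixes g :: "nat \<Rightarrow> 'a"
  assumes reg: "partition_regular (sum_quotient_pattern q c d)" and g: "finite (range g)"
  obtains x y z w where "x > 0" "y > 0" "z > 0" "w \<ge> N" "g y = g x" "g z = g x" "g w = g x"
    "int z = c * int x + d * int y" "of_nat w * of_nat x = q * of_nat y"
proof -
  define h where "h n = (min n N, g n)" for n
  have "finite (range h)"
    by (rule finite_subset[OF _ finite_cartesian_product[OF finite_atMost[of N] g]])
      (auto simp: h_def)
  from partition_regular_colouring[OF reg this]
  have inf: "infinite {t. (\<exists>k. \<forall>z\<in>set t. \<exists>n>0. z = of_nat n \<and> h n = k) \<and>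
    (\<exists>u>0. \<exists>v>0. t = map (\<lambda>f. f u v) (sum_quotient_pattern q c d))}" (is "infinite ?T") .
  then obtain t where t: "t \<in> ?T" "t \<notin> (\<lambda>n. replicate 4 (of_nat n)) ` {..<N}"
    by (meson finite_imageI finite_lessThan finite_subset subsetI)
  from t(1) obtain k x y where k: "\<forall>z\<in>set t. \<exists>n>0. z = of_nat n \<and> h n = k"
    and xy: "x > 0" "y > 0" and t_eq: "t = map (\<lambda>f. f x y) (sum_quotient_pattern q c d)"
    by auto
  obtain z w where z: "z > 0" "of_nat z = of_int c * of_nat x + of_int d * (of_nat y :: rat)" "h z = k"
    and w: "w > 0" "of_nat w = q * (of_nat y / of_nat x)" "h w = k"
    and hxy: "h x = k" "h y = k"
    using k unfolding t_eq by fastforce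
  have "fst k \<ge> N"
  proof (rule ccontr)
    assume "\<not> fst k \<ge> N"
    then have "\<forall>z\<in>set t. z = of_nat (fst k)"
      using k by (fastforce simp: h_def min_def split: if_splits)
    then have "replicate (length t) (of_nat (fst k)) = t" by (intro replicate_length_same)
    moreover have "length t = 4" by (simp add: t_eq)
    ultimately have "t = replicate 4 (of_nat (fst k))" by simp
    with t(2) \<open>\<not> fst k \<ge> N\<close> show False by auto
  qed
  then have "w \<ge> N" using w(3) by (auto simp: h_def)
  moreover have "(of_int (int z) :: rat) = of_int (c * int x + d * int y)"
    using z(2) by simp
  then have "int z = c * int x + d * int y" by (simp only: of_int_eq_iff)
  moreover have "of_nat w * of_nat x = q * of_nat y"
    using w(2) xy by (simp add: field_simps)
  moreover have "g x = snd k" "g y = snd k" "g z = snd k" "g w = snd k"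
    using hxy z(3) w(3) by (auto simp: h_def)
  ultimately show thesis
    using that[of x y z w] xy z(1) \<open>w \<ge> N\<close> by simp
qed

lemma partition_regular_imp_d:
  assumes "q > 0" "d \<noteq> 0" and reg: "partition_regular (sum_quotient_pattern q c d)"
  shows "d = 1"
proof -
  \<comment> \<open>In half steps, multiplying by \<open>d \<ge> 2\<close> shifts by 2. The error
    from \<open>c * x\<close> keeps the shift of the floor between 1 and 3, never 0 modulo
    4.\<close>
  define g where "g n = \<lfloor>2 * log (real_of_int d) (real n)\<rfloor> mod 4" for n
  have "finite (range g)"
    by (rule finite_subset[of _ "{0..<4}"]) (auto simp: g_def)
  \<comment> \<open>Chosen so that \<open>y = w * x / q\<close> exceeds twice the absolute value of
    \<open>c * x\<close>.\<close>
  moreover define N where "N = nat \<lceil>q * of_int (2 * (\<bar>c\<bar> + 1))\<rceil>"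
  ultimately obtain x y z w where *: "x > 0" "y > 0" "z > 0" "w \<ge> N" "g y = g x" "g z = g x"
      "int z = c * int x + d * int y" "of_nat w * of_nat x = q * of_nat y"
    using sum_quotient_solution[OF reg, of g N] by metis
  have "q * of_int (2 * (\<bar>c\<bar> + 1)) \<le> of_nat N"
    unfolding N_def by linarith
  also have "\<dots> \<le> of_nat w" using * by simp
  finally have "q * of_int (2 * (\<bar>c\<bar> + 1)) * of_nat x \<le> of_nat w * of_nat x"
    by (intro mult_right_mono) auto
  then have "q * (of_int (2 * (\<bar>c\<bar> + 1)) * of_nat x) \<le> q * of_nat y"
    using * by (simp add: mult.assoc)
  then have "(of_int (2 * (\<bar>c\<bar> + 1) * int x) :: rat) \<le> of_int (int y)"
    using \<open>q > 0\<close> by simp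
  then have "2 * (\<bar>c\<bar> + 1) * int x \<le> int y" by (simp only: of_int_le_iff)
  then have *: "2 * \<bar>c * int x\<bar> < int y" and *: "x > 0" "y > 0" "z > 0" "g y = g z"
      "int z = c * int x + d * int y"
    using * by (auto simp: abs_mult algebra_simps)
  show ?thesis
  proof (rule ccontr)
    assume "d \<noteq> 1"
    show False
    proof (cases "d < 0")
      case True
      \<comment> \<open>The term \<open>d * y\<close> outweighs \<open>c * x\<close>, so
        \<open>z\<close> would be negative.\<close>
      then have "d * int y \<le> - 1 * int y" by (intro mult_right_mono) auto
      then show False using * \<open>2 * \<bar>c * int x\<bar> < int y\<close> by linarith
    next
      case False
      with \<open>d \<noteq> 0\<close> \<open>d \<noteq> 1\<close> have d: "d \<ge> 2" by simp
      define D where "D = real_of_int d"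
      have D: "D \<ge> 2" using d by (simp add: D_def)
      have "real z = of_int c * real x + D * real y"
        unfolding D_def using arg_cong[OF *(5), of real_of_int] by simp
      moreover have "2 * \<bar>of_int c * real x\<bar> < real y"
        using \<open>2 * \<bar>c * int x\<bar> < int y\<close>
        by (metis (mono_tags, opaque_lifting) of_int_abs of_int_less_iff of_int_mult
            of_int_numeral of_int_of_nat_eq)
      ultimately have z: "real z \<le> (D + 1/2) * real y" "real z \<ge> (D - 1/2) * real y"
        unfolding distrib_right left_diff_distrib by linarith+
      have "sqrt D ^ 2 = D" using D by simp
      \<comment> \<open>A rational bound below the square root of 2, good enough to place
        \<open>z / y\<close> between \<open>sqrt D\<close> and \<open>D * sqrt D\<close>.\<close>
      have s: "sqrt D \<ge> 7/5" using D by (intro real_le_rsqrt) (simp add: power2_eq_square)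
      have "sqrt D \<le> D - 1/2"
      proof -
        have "0 \<le> (sqrt D - 7/5) * (sqrt D + 2/5)" using s by (intro mult_nonneg_nonneg) auto
        then show ?thesis using \<open>sqrt D ^ 2 = D\<close> by (simp add: power2_eq_square algebra_simps)
      qed
      moreover have "D + 1/2 < D * sqrt D"
      proof -
        have "D * (7/5) \<le> D * sqrt D" using D s by (intro mult_left_mono) auto
        then show ?thesis using D by linarith
      qed
      ultimately have "sqrt D * real y \<le> real z" "real z < D * sqrt D * real y"
        using z * by (smt (verit) mult_right_mono mult_strict_right_mono of_nat_0_less_iff)+
      then have "log D (sqrt D * real y) \<le> log D (real z)"
        "log D (real z) < log D (D * sqrt D * real y)"
        using D * by (auto intro!: log_mono log_less)
      moreover have "log D (sqrt D) = 1/2" using D by (simp add: log_def ln_sqrt)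
      moreover have "log D (sqrt D * real y) = log D (sqrt D) + log D (real y)"
        "log D (D * sqrt D * real y) = 1 + log D (sqrt D) + log D (real y)"
        using D * by (simp_all add: log_mult)
      ultimately have "2 * log D (real z) \<ge> 2 * log D (real y) + 1"
        "2 * log D (real z) < 2 * log D (real y) + 3" by linarith+
      then have "\<lfloor>2 * log D (real z)\<rfloor> \<ge> \<lfloor>2 * log D (real y)\<rfloor> + 1"
        "\<lfloor>2 * log D (real z)\<rfloor> \<le> \<lfloor>2 * log D (real y)\<rfloor> + 3"
        by linarith+
      moreover have "\<lfloor>2 * log D (real y)\<rfloor> mod 4 = \<lfloor>2 * log D (real z)\<rfloor> mod 4"
        using *(4) by (simp add: g_def D_def)
      ultimately show False by presburger
    qed
  qed
qed

text \<open>With \<open>d = 1\<close>, size no longer separates \<open>z\<close> from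
  \<open>y\<close>, so the obstruction is \<open>p\<close>-adic.\<close>

lemma partition_regular_imp_c:
  assumes "q > 0" "c \<noteq> 0" and reg: "partition_regular (sum_quotient_pattern q c 1)"
  shows "c = 1"
proof (rule ccontr)
  assume "c \<noteq> 1"
  obtain a b where "q = of_int a / of_int b" "b > 0"
    by (metis surj_pair quotient_of_div quotient_of_denom_pos)
  then have ab: "a > 0" "b > 0" "q = of_int a / of_int b"
    using \<open>q > 0\<close> by (simp_all add: zero_less_divide_iff)
  \<comment> \<open>Large enough to divide none of the nonzero integers \<open>c\<close>,
    \<open>c - 1\<close>, \<open>a\<close>, \<open>b\<close>.\<close>
  obtain p' :: nat where p': "prime p'" "p' > nat (\<bar>c\<bar> + \<bar>c - 1\<bar> + a + b)"
    using bigger_prime by blast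
  define p where "p = int p'"
  have p: "prime p" "p > \<bar>c\<bar> + \<bar>c - 1\<bar> + a + b" using p' by (auto simp: p_def)
  have "\<not> p dvd n" if "n \<noteq> 0" "\<bar>n\<bar> < p" for n
    using dvd_imp_le_int[of n p] that by auto
  then have nd: "\<not> p dvd c" "\<not> p dvd c - 1" "\<not> p dvd a" "\<not> p dvd b"
    using p(2) ab(1,2) \<open>c \<noteq> 0\<close> \<open>c \<noteq> 1\<close> by auto
  \<comment> \<open>For positive \<open>n\<close> the second component is the last nonzero digit in
    base \<open>p\<close>.\<close>
  define g where
    "g n = (p dvd int n, (int n div p ^ multiplicity p (int n)) mod p)" for n
  have "finite (range g)"
    by (rule finite_subset[of _ "UNIV \<times> {0..<p}"]) (use p ab in \<open>auto simp: g_def\<close>)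
  then obtain x y z w where *: "x > 0" "y > 0" "z > 0" "g y = g x" "g z = g x" "g w = g x"
      "int z = c * int x + int y" "of_nat w * of_nat x = q * of_nat y"
    using sum_quotient_solution[OF reg, of g 0] by (metis mult_1)
  have "(of_int (b * int w * int x) :: rat) = of_int (a * int y)"
    using *(8) ab by (simp add: field_simps)
  then have eq: "b * int w * int x = a * int y" by (simp only: of_int_eq_iff)
  show False
  proof (cases "p dvd int w")
    case False
    then have n: "\<not> p dvd int x" "\<not> p dvd int y" "\<not> p dvd int z" using * by (auto simp: g_def)
    then have "int y mod p = int x mod p" "int z mod p = int y mod p"
      using * by (auto simp: g_def not_dvd_imp_multiplicity_0)
    then have "p dvd int z - int y" by (simp add: mod_eq_dvd_iff)
    then have "p dvd c * int x" by (simp add: *(7))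
    then show False using p nd n by (auto simp: prime_dvd_mult_iff)
  next
    case True
    define i where "i = multiplicity p (int x)"
    have "int x \<noteq> 0" "\<not> is_unit p" using *(1) p(1) by auto
    then obtain x' where x': "int x = p ^ i * x'" "\<not> p dvd x'"
      unfolding i_def by (rule multiplicity_decompose')
    \<comment> \<open>The factor \<open>w\<close> contributes an extra \<open>p\<close>, so
      \<open>y\<close> has larger valuation than \<open>x\<close>.\<close>
    have "p ^ Suc i dvd a * int y"
      unfolding eq[symmetric] x' using True by (auto elim!: dvdE)
    then have "p ^ Suc i dvd int y"
      using p nd by (simp add: coprime_dvd_mult_right_iff prime_imp_coprime)
    then obtain k where k: "int y = p ^ Suc i * k" by (elim dvdE)
    \<comment> \<open>Modulo \<open>p\<close> the term from \<open>y\<close> vanishes, so the last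
      nonzero digit of \<open>z\<close> is that of \<open>x\<close> times \<open>c\<close>.\<close>
    have z: "int z = p ^ i * (c * x' + p * k)"
      using * k x' by (simp add: algebra_simps)
    have "\<not> p dvd c * x' + p * k"
      using x' nd p by (simp add: dvd_add_left_iff prime_dvd_mult_iff)
    then have "multiplicity p (int z) = i"
      using z p by (intro multiplicity_decomposeI) auto
    then have "int z div p ^ multiplicity p (int z) = c * x' + p * k"
      using z p by auto
    moreover have "int x div p ^ multiplicity p (int x) = x'"
      unfolding i_def[symmetric] using x' p by auto
    ultimately have "(c * x') mod p = x' mod p"
      using *(5) by (simp add: g_def)
    then have "p dvd (c - 1) * x'" by (simp add: mod_eq_dvd_iff algebra_simps)
    then show False using x' nd p by (simp add: prime_dvd_mult_iff)
  qed
qed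

theorem theorem1p7:
  fixes q :: rat and c d :: int
  assumes "q > 0" and "c \<noteq> 0" and "d \<noteq> 0"
  shows "partition_regular
           [\<lambda>x y. of_nat x,
            \<lambda>x y. of_nat y,
            \<lambda>x y. of_int c * of_nat x + of_int d * of_nat y,
            \<lambda>x y. q * (of_nat y / of_nat x)]
         \<longleftrightarrow> c = 1 \<and> d = 1"
  using assms partition_regular_sum_quotient partition_regular_imp_d partition_regular_imp_c
  by blast

end
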